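(* Let $\lambda>-\frac12$, $m\in\{0,1,2,\ldots\}$, and for each $\kappa>-\frac12$ let $Z_\kappa$ have density $$g_\kappa(x)=\frac1{\sqrt\pi}\frac{\Gamma(\kappa+1)}{\Gamma(\kappa+\frac12)}(1-x^2)^{\kappa-\frac12},\qquad|x|\le1.$$ Then for all $F\in\mathcal{C}_c^\infty$, $$E\,G_\lambda^m(Z_\lambda)F(Z_\lambda)=\alpha_\lambda^{(m)}\,E\,F^{(m)}(Z_{\lambda+m}),$$ and hence $(Z_\lambda)_\lambda^{(m)}=Z_{\lambda+m}$ in distribution; that is, the $m$-th order transformation induced by the Gegenbauer polynomial $G_\lambda^m$ maps the distribution with density $g_\lambda$ to the distribution with density $g_{\lambda+m}$.
   Context: The constants are $$\alpha_\lambda^{(m)}=\frac{\Gamma(\lambda)\Gamma(2\lambda+m)\Gamma(\lambda+1)}{2^{2m}\Gamma(\lambda+m+1)\Gamma(\lambda+m)\Gamma(2\lambda)},$$ interpreted at $\lambda=0$ as the limit $\lambda\to0$. The (monic, degree $m$) Gegenbauer polynomials are defined by the Rodriguez formula $$G_\lambda^m(x)=(-1)^m\alpha_\lambda^{(m)}\frac{\Gamma(\lambda+\frac12)\Gamma(\lambda+m+1)}{\Gamma(\lambda+1)\Gamma(\lambda+m+\frac12)}(1-x^2)^{\frac12-\lambda}\frac{d^m}{dx^m}\left\{(1-x^2)^{\lambda+m-\frac12}\right\};$$ they are orthogonal with respect to $g_\lambda$. $\mathcal{C}_c^\infty$ is the set of infinitely differentiable compactly supported functions on $\mathbf{R}$.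 For $X$ whose moments up to order $2m$ agree with those of $Z_\lambda$, $X_\lambda^{(m)}$ denotes a variable with the $X$-$G_\lambda^m$ biased distribution, the unique distribution characterized by $E\,G_\lambda^m(X)F(X)=\alpha\,E\,F^{(m)}(X_\lambda^{(m)})$ with $\alpha=\frac1{m!}E[X^mG_\lambda^m(X)]$; it is determined by this equality for all $F\in\mathcal{C}_c^\infty$. *)

theory Defs
  imports "HOL-Probability.Probability" "HOL-Computational_Algebra.Polynomial"
begin

definition gegenbauer_density :: "real \<Rightarrow> real \<Rightarrow> real" where
  "gegenbauer_density \<kappa> x =
     (if \<bar>x\<bar> \<le> 1
      then 1 / sqrt pi * (Gamma (\<kappa> + 1) / Gamma (\<kappa> + 1/2)) * (1 - x\<^sup>2) powr (\<kappa> - 1/2)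
      else 0)"

definition gegenbauer_distr :: "real \<Rightarrow> real measure" where
  "gegenbauer_distr \<kappa> = density lborel (\<lambda>x. ennreal (gegenbauer_density \<kappa> x))"

(* For l = 0 the arguments l and 2 * l are poles of Gamma, where the library sets Gamma to 0;
   hence the separate limit in gegenbauer_alpha. *)
definition gegenbauer_alpha_quot :: "nat \<Rightarrow> real \<Rightarrow> real" where
  "gegenbauer_alpha_quot m l =
     (Gamma l * Gamma (2 * l + real m) * Gamma (l + 1)) /
     (2 ^ (2 * m) * Gamma (l + real m + 1) * Gamma (l + real m) * Gamma (2 * l))"

definition gegenbauer_alpha :: "real \<Rightarrow> nat \<Rightarrow> real" where
  "gegenbauer_alpha l m =
     (if l = 0 then Lim (at 0) (gegenbauer_alpha_quot m) else gegenbauer_alpha_quot m l)"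

definition gegenbauer_rodrigues :: "real \<Rightarrow> nat \<Rightarrow> real \<Rightarrow> real" where
  "gegenbauer_rodrigues l m x =
     (-1) ^ m * gegenbauer_alpha l m *
     ((Gamma (l + 1/2) * Gamma (l + real m + 1)) / (Gamma (l + 1) * Gamma (l + real m + 1/2))) *
     (1 - x\<^sup>2) powr (1/2 - l) *
     (deriv ^^ m) (\<lambda>y. (1 - y\<^sup>2) powr (l + real m - 1/2)) x"

(* The Rodrigues formula is meaningful only for -1 < x < 1, but it determines the polynomial. *)
definition gegenbauer_poly :: "real \<Rightarrow> nat \<Rightarrow> real poly" where
  "gegenbauer_poly l m =
     (THE p. \<forall>x\<in>{-1<..<1}. poly p x = gegenbauer_rodrigues l m x)"

definition Cc_infty :: "(real \<Rightarrow> real) set" where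
  "Cc_infty = {F. (\<forall>n x. (deriv ^^ n) F differentiable (at x)) \<and>
                  compact (closure {x. F x \<noteq> 0})}"

definition moments_agree :: "nat \<Rightarrow> real measure \<Rightarrow> real measure \<Rightarrow> bool" where
  "moments_agree n \<mu> \<nu> \<longleftrightarrow>
     (\<forall>k\<le>n. integrable \<mu> (\<lambda>x. x ^ k) \<and> integrable \<nu> (\<lambda>x. x ^ k) \<and>
            (\<integral>x. x ^ k \<partial>\<mu>) = (\<integral>x. x ^ k \<partial>\<nu>))"

definition is_gegenbauer_biased :: "real \<Rightarrow> nat \<Rightarrow> real measure \<Rightarrow> real measure \<Rightarrow> bool" where
  "is_gegenbauer_biased l m \<mu> \<nu> \<longleftrightarrow>
     real_distribution \<mu> \<and> moments_agree (2 * m) \<mu> (gegenbauer_distr l) \<and>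
     real_distribution \<nu> \<and>
     (\<forall>F\<in>Cc_infty.
        (\<integral>x. poly (gegenbauer_poly l m) x * F x \<partial>\<mu>) =
        1 / fact m * (\<integral>x. x ^ m * poly (gegenbauer_poly l m) x \<partial>\<mu>) *
        (\<integral>x. (deriv ^^ m) F x \<partial>\<nu>))"

definition gegenbauer_biased :: "real \<Rightarrow> nat \<Rightarrow> real measure \<Rightarrow> real measure" where
  "gegenbauer_biased l m \<mu> = (THE \<nu>. is_gegenbauer_biased l m \<mu> \<nu>)"

end

theory Submission imports Defs begin

text \<open>
  The function \<open>(1 - x\<^sup>2) powr (l + m - 1/2)\<close> is the density of \<open>Z (l + m)\<close> up to a constant, and by
  the Rodrigues formula its \<open>m\<close>-th derivative is \<open>(-1) ^ m\<close> times the Gegenbauer polynomial times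
  the density of \<open>Z l\<close>, again up to a constant.
  So the identity for test functions \<open>F \<in> Cc_infty\<close> is \<open>m\<close> integrations by parts on the interval from -1 to 1
  (\<open>weighted_integral_rodrigues_factor\<close>). No boundary terms appear, because every exponent that
  occurs in them is at least \<open>l + 1/2 > 0\<close>. The Gamma factors in the Rodrigues formula are exactly
  the quotient of the two normalising constants, which leaves only the factor \<open>gegenbauer_alpha l m\<close>
  (\<open>gegenbauer_integral_identity\<close>).

  The identity holds for every smooth \<open>F\<close>. Applied to \<open>x ^ m\<close> it shows that the constant in the
  definition of the biased distribution is \<open>gegenbauer_alpha l m\<close>, so that \<open>gegenbauer_distr (l + m)\<close>
  is a biased distribution. Since the constant does not vanish (\<open>gegenbauer_alpha_nonzero\<close>), another
  biased distribution gives the same integral to every \<open>m\<close>-th derivative of a test function, and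
  it remains to see that these integrals determine a probability measure
  (\<open>real_distribution_eqI_funpow_deriv\<close>).
  An \<open>m\<close>-th derivative of a test function is orthogonal to the polynomials of degree below \<open>m\<close>, but
  no such polynomial except 0 is the difference of two probability measures. Concretely, for a test function
  \<open>F\<close> the difference \<open>F x - F (x - N)\<close> is the derivative of a test function, and the
  integral of its second part tends to 0 as \<open>N\<close> tends to infinity. Hence one derivative can be
  removed at a time.
\<close>

section \<open>Smooth functions and test functions\<close>

definition smooth :: "(real \<Rightarrow> real) \<Rightarrow> bool" where
  "smooth f \<longleftrightarrow> (\<forall>n x. (deriv ^^ n) f differentiable (at x))"

lemma smooth_funpow_deriv: "smooth f \<Longrightarrow> smooth ((deriv ^^ k) f)"
  unfolding smooth_def by (metis comp_apply funpow_add)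

lemma smooth_deriv: "smooth f \<Longrightarrow> smooth (deriv f)"
  using smooth_funpow_deriv[of f 1] by simp

lemma smooth_has_deriv: "smooth f \<Longrightarrow> (f has_real_derivative deriv f x) (at x)"
  unfolding smooth_def
  by (metis DERIV_deriv_iff_real_differentiable funpow_0)

lemma smooth_imp_continuous: "smooth f \<Longrightarrow> continuous_on UNIV f"
  using smooth_has_deriv by (meson DERIV_continuous_on has_field_derivative_at_within)

lemma smooth_isCont: "smooth f \<Longrightarrow> isCont f x"
  using smooth_has_deriv DERIV_isCont by blast

lemma smooth_borel: "smooth f \<Longrightarrow> f \<in> borel_measurable borel"
  using smooth_imp_continuous borel_measurable_continuous_onI by blast

text \<open>Instead of computing higher derivatives it suffices to exhibit a class of functions that is
  closed under differentiation.\<close>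

lemma smooth_coinduct:
  assumes "P f"
    and step: "\<And>g. P g \<Longrightarrow> \<exists>g'. P g' \<and> (\<forall>x. (g has_real_derivative g' x) (at x))"
  shows "smooth f"
proof -
  have P: "P ((deriv ^^ n) f)" for n
  proof (induction n)
    case 0
    then show ?case using assms(1) by simp
  next
    case (Suc n)
    obtain g' where g': "P g'" "\<And>x. ((deriv ^^ n) f has_real_derivative g' x) (at x)"
      using step[OF Suc] by blast
    then have "deriv ((deriv ^^ n) f) = g'"
      by (intro ext DERIV_imp_deriv)
    then show ?case using g' by simp
  qed
  show ?thesis
    unfolding smooth_def
  proof (intro allI)
    fix n x
    show "(deriv ^^ n) f differentiable at x"
      using step[OF P[of n]] unfolding real_differentiable_def by blast
  qed
qed

lemma smooth_antideriv:
  assumes "smooth f" "\<And>x. (g has_real_derivative f x) (at x)"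
  shows "smooth g"
proof (rule smooth_coinduct[where P = "\<lambda>h. h = g \<or> smooth h"])
  show "\<exists>h'. (h' = g \<or> smooth h') \<and> (\<forall>x. (h has_real_derivative h' x) (at x))"
    if "h = g \<or> smooth h" for h
    using that
  proof
    assume "h = g"
    then show ?thesis using assms by (intro exI[of _ f]) simp
  next
    assume "smooth h"
    then show ?thesis by (intro exI[of _ "deriv h"]) (simp add: smooth_deriv smooth_has_deriv)
  qed
qed simp

lemma smooth_diff_shift:
  assumes "smooth f"
  shows "smooth (\<lambda>x. f x - f (x - c))"
proof (rule smooth_coinduct[where P = "\<lambda>g. \<exists>f. smooth f \<and> g = (\<lambda>x. f x - f (x - c))"])
  show "\<exists>h'. (\<exists>f. smooth f \<and> h' = (\<lambda>x. f x - f (x - c))) \<and> (\<forall>x. (h has_real_derivative h' x) (at x))"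
    if "\<exists>f. smooth f \<and> h = (\<lambda>x. f x - f (x - c))" for h
  proof -
    from that obtain f where f: "smooth f" and h: "h = (\<lambda>x. f x - f (x - c))" by blast
    have "(h has_real_derivative deriv f x - deriv f (x - c)) (at x)" for x
      unfolding h
      by (auto intro!: derivative_eq_intros DERIV_chain'[OF _ smooth_has_deriv[OF f]] smooth_has_deriv[OF f])
    then show ?thesis
      by (intro exI[of _ "\<lambda>x. deriv f x - deriv f (x - c)"] conjI exI[of _ "deriv f"] smooth_deriv f refl allI)
  qed
  show "\<exists>f'. smooth f' \<and> (\<lambda>x. f x - f (x - c)) = (\<lambda>x. f' x - f' (x - c))"
    using assms by blast
qed

lemma funpow_deriv_diff_shift:
  assumes "smooth f"
  shows "(deriv ^^ k) (\<lambda>x. f x - f (x - c)) = (\<lambda>x. (deriv ^^ k) f x - (deriv ^^ k) f (x - c))"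
proof (induction k)
  case 0
  then show ?case by simp
next
  case (Suc k)
  let ?g = "(deriv ^^ k) f"
  have g: "smooth ?g" by (rule smooth_funpow_deriv[OF assms])
  have "deriv (\<lambda>x. ?g x - ?g (x - c)) x = deriv ?g x - deriv ?g (x - c)" for x
    by (rule DERIV_imp_deriv)
      (auto intro!: derivative_eq_intros DERIV_chain'[OF _ smooth_has_deriv[OF g]] smooth_has_deriv[OF g])
  then show ?case using Suc by auto
qed

lemma Cc_infty_iff:
  "F \<in> Cc_infty \<longleftrightarrow> smooth F \<and> (\<exists>R. \<forall>x. \<bar>x\<bar> > R \<longrightarrow> F x = 0)"
proof -
  have "compact (closure {x. F x \<noteq> 0}) \<longleftrightarrow> bounded {x. F x \<noteq> 0}"
    by (simp add: compact_closure)
  also have "\<dots> \<longleftrightarrow> (\<exists>R. \<forall>x. \<bar>x\<bar> > R \<longrightarrow> F x = 0)"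
    unfolding bounded_iff real_norm_def mem_Collect_eq by (simp only: not_le[symmetric]) blast
  finally show ?thesis by (simp add: Cc_infty_def smooth_def)
qed

lemma Cc_infty_funpow_deriv:
  assumes "F \<in> Cc_infty" shows "(deriv ^^ k) F \<in> Cc_infty"
proof -
  obtain R where sm: "smooth F" and R: "\<And>x. \<bar>x\<bar> > R \<Longrightarrow> F x = 0"
    using assms unfolding Cc_infty_iff by blast
  have "(deriv ^^ k) F x = 0" if "\<bar>x\<bar> > R" for x
    using that
  proof (induction k arbitrary: x)
    case 0
    then show ?case using R by simp
  next
    case (Suc k)
    have "open {y::real. \<bar>y\<bar> > R}"
      by (intro open_Collect_less continuous_intros)
    then have "((deriv ^^ k) F has_real_derivative 0) (at x)"
      using has_field_derivative_transform_within_open[of "\<lambda>_. 0" 0 x "{y. \<bar>y\<bar> > R}"] Suc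
      by auto
    then show ?case using DERIV_imp_deriv by fastforce
  qed
  then show ?thesis using sm smooth_funpow_deriv unfolding Cc_infty_iff by blast
qed

lemma Cc_infty_bounded:
  assumes "F \<in> Cc_infty" obtains B where "\<And>x. \<bar>F x\<bar> \<le> B"
proof -
  obtain R where sm: "smooth F" and R: "\<And>x. \<bar>x\<bar> > R \<Longrightarrow> F x = 0"
    using assms unfolding Cc_infty_iff by blast
  have "compact (F ` {-R..R})"
    by (intro compact_continuous_image continuous_on_subset[OF smooth_imp_continuous[OF sm]]) auto
  then obtain B where "\<forall>y\<in>F ` {-R..R}. norm y \<le> B"
    using compact_imp_bounded[of "F ` {-R..R}"] unfolding bounded_iff by blast
  then have B: "\<bar>F x\<bar> \<le> B" if "x \<in> {-R..R}" for x
    using that by auto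
  have "\<bar>F x\<bar> \<le> max B 0" for x
  proof (cases "\<bar>x\<bar> > R")
    case False
    then have "x \<in> {-R..R}" by auto
    then show ?thesis using B[of x] by auto
  qed (simp add: R)
  then show ?thesis by (rule that)
qed

text \<open>A primitive \<open>P\<close> of \<open>F\<close> is constant to the left and to the right of the support, but with
  different constants in general. In \<open>P x - P (x - c)\<close> these constants cancel, so the support of
  this function is bounded.\<close>

lemma diff_shift_has_antiderivative:
  assumes "F \<in> Cc_infty"
  obtains G where "G \<in> Cc_infty" "deriv G = (\<lambda>x. F x - F (x - c))"
proof -
  obtain R where sm: "smooth F" and R: "\<And>x. \<bar>x\<bar> > R \<Longrightarrow> F x = 0"
    using assms unfolding Cc_infty_iff by blast
  have "\<exists>P. \<forall>x::real. -\<infinity> < ereal x \<longrightarrow> ereal x < \<infinity> \<longrightarrow> (P has_vector_derivative F x) (at x)"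
    by (rule einterval_antiderivative) (auto simp: smooth_isCont[OF sm])
  then obtain P where P: "\<And>x. (P has_real_derivative F x) (at x)"
    by (auto simp: has_real_derivative_iff_has_vector_derivative)
  have eq: "P x = P y" if "\<And>z. min x y \<le> z \<Longrightarrow> z \<le> max x y \<Longrightarrow> \<bar>z\<bar> > R" for x y
  proof -
    have "\<forall>z\<in>{min x y..max x y}. (P has_real_derivative 0) (at z within {min x y..max x y})"
    proof
      fix z assume z: "z \<in> {min x y..max x y}"
      then have "F z = 0" using that R by auto
      then show "(P has_real_derivative 0) (at z within {min x y..max x y})"
        using P[of z] has_field_derivative_at_within by metis
    qed
    then have "\<exists>c. \<forall>z\<in>{min x y..max x y}. P z = c"
      using has_field_derivative_zero_constant[of "{min x y..max x y}" P] by auto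
    then show ?thesis by (metis atLeastAtMost_iff max.cobounded1 max.cobounded2 min.cobounded1 min.cobounded2)
  qed
  define G where "G = (\<lambda>x. P x - P (x - c))"
  have G: "(G has_real_derivative F x - F (x - c)) (at x)" for x
    unfolding G_def by (auto intro!: derivative_eq_intros DERIV_chain'[OF _ P] P)
  have "G x = 0" if "\<bar>x\<bar> > \<bar>R\<bar> + \<bar>c\<bar>" for x
    unfolding G_def using eq[of x "x - c"] that by (auto simp: min_def max_def split: if_splits)
  then have "G \<in> Cc_infty"
    using smooth_antideriv[OF smooth_diff_shift[OF sm] G] unfolding Cc_infty_iff by blast
  moreover have "deriv G = (\<lambda>x. F x - F (x - c))"
    using G DERIV_imp_deriv by blast
  ultimately show ?thesis by (rule that)
qed

section \<open>Measures determined by derivatives of test functions\<close>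

lemma Cc_infty_integrable:
  assumes "real_distribution \<mu>" "F \<in> Cc_infty"
  shows "integrable \<mu> (\<lambda>x. F (x - c))"
proof -
  interpret real_distribution \<mu> by fact
  obtain B where "\<And>x. \<bar>F x\<bar> \<le> B" using Cc_infty_bounded[OF assms(2)] by blast
  moreover have "F \<in> borel_measurable borel" using assms(2) smooth_borel unfolding Cc_infty_iff by blast
  ultimately show ?thesis by (intro integrable_const_bound[where B=B]) auto
qed

text \<open>The mass of a probability measure does not escape to infinity, but the support of the shifted
  function does.\<close>

lemma integral_shift_tendsto_0:
  assumes "real_distribution \<mu>" "F \<in> Cc_infty"
  shows "(\<lambda>N. \<integral>x. F (x - real N) \<partial>\<mu>) \<longlonglongrightarrow> 0"
proof -
  interpret real_distribution \<mu> by fact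
  obtain R where R: "\<And>x. \<bar>x\<bar> > R \<Longrightarrow> F x = 0" and sm: "smooth F" using assms(2) unfolding Cc_infty_iff by blast
  obtain B where B: "\<And>x. \<bar>F x\<bar> \<le> B" using Cc_infty_bounded[OF assms(2)] by blast
  have [measurable]: "F \<in> borel_measurable borel" using sm smooth_borel by blast
  have "(\<lambda>N. F (x - real N)) \<longlonglongrightarrow> 0" for x
  proof (rule tendsto_eventually)
    obtain N0 :: nat where "real N0 > x + \<bar>R\<bar>" using reals_Archimedean2 by blast
    then have "F (x - real N) = 0" if "N \<ge> N0" for N
      using that by (intro R) linarith
    then show "\<forall>\<^sub>F N in sequentially. F (x - real N) = 0"
      unfolding eventually_sequentially by blast
  qed
  then have "(\<lambda>N. \<integral>x. F (x - real N) \<partial>\<mu>) \<longlonglongrightarrow> (\<integral>x. 0 \<partial>\<mu>)"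
    by (intro integral_dominated_convergence[where w = "\<lambda>_. B"]) (auto simp: B)
  then show ?thesis by simp
qed

text \<open>With \<open>G\<close> a test function such that \<open>G' x = F x - F (x - c)\<close>, the hypothesis for \<open>G\<close> says that the
  two measures agree on \<open>g x - g (x - c)\<close>, where \<open>g\<close> is the \<open>k\<close>-th derivative of \<open>F\<close>. The shifted
  part disappears in the limit of large \<open>c\<close>.\<close>

lemma integral_deriv_descent:
  assumes \<mu>: "real_distribution \<mu>" and \<nu>: "real_distribution \<nu>"
    and eq: "\<And>F. F \<in> Cc_infty \<Longrightarrow> (\<integral>x. (deriv ^^ Suc k) F x \<partial>\<mu>) = (\<integral>x. (deriv ^^ Suc k) F x \<partial>\<nu>)"
    and F: "F \<in> Cc_infty"
  shows "(\<integral>x. (deriv ^^ k) F x \<partial>\<mu>) = (\<integral>x. (deriv ^^ k) F x \<partial>\<nu>)"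
proof -
  let ?g = "(deriv ^^ k) F"
  have g: "?g \<in> Cc_infty" by (rule Cc_infty_funpow_deriv[OF F])
  have int: "(\<integral>x. ?g x - ?g (x - c) \<partial>M) = (\<integral>x. ?g x \<partial>M) - (\<integral>x. ?g (x - c) \<partial>M)"
    if "real_distribution M" for M c
    using Cc_infty_integrable[OF that g, of 0] Cc_infty_integrable[OF that g, of c] by simp
  have shift: "(\<integral>x. ?g x \<partial>\<mu>) - (\<integral>x. ?g (x - c) \<partial>\<mu>) = (\<integral>x. ?g x \<partial>\<nu>) - (\<integral>x. ?g (x - c) \<partial>\<nu>)" for c
  proof -
    obtain G where "G \<in> Cc_infty" and G: "deriv G = (\<lambda>x. F x - F (x - c))"
      using diff_shift_has_antiderivative[OF F] by blast
    moreover have "(deriv ^^ Suc k) G = (\<lambda>x. ?g x - ?g (x - c))"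
      using F funpow_deriv_diff_shift[of F k c] by (simp only: funpow_Suc_right comp_apply G Cc_infty_iff)
    ultimately show ?thesis using eq[of G] int[OF \<mu>] int[OF \<nu>] by simp
  qed
  have "(\<lambda>N. (\<integral>x. ?g x \<partial>M) - (\<integral>x. ?g (x - real N) \<partial>M)) \<longlonglongrightarrow> (\<integral>x. ?g x \<partial>M)"
    if "real_distribution M" for M
    using tendsto_diff[OF tendsto_const integral_shift_tendsto_0[OF that g]] by simp
  from this[OF \<mu>] this[OF \<nu>] show ?thesis
    by (simp only: shift) (rule LIMSEQ_unique)
qed

text \<open>The powers of \<open>s\<close> in the denominator make the family of all \<open>flat_exp k\<close>, with polynomial
  coefficients, closed under differentiation. The classical smooth function that is flat at 0
  is \<open>flat_exp 0\<close>.\<close>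

definition flat_exp :: "nat \<Rightarrow> real \<Rightarrow> real" where
  "flat_exp k s = (if s > 0 then exp (- 1 / s) / s ^ k else 0)"

lemma flat_exp_shift: "flat_exp k s = s ^ j * flat_exp (k + j) s"
  by (auto simp: flat_exp_def power_add)

lemma flat_exp_has_derivative:
  "(flat_exp k has_real_derivative flat_exp (k + 2) s - real k * flat_exp (k + 1) s) (at s)"
proof -
  consider "s > 0" | "s < 0" | "s = 0" by linarith
  then show ?thesis
  proof cases
    case 1
    have "((\<lambda>s. exp (- 1 / s) / s ^ k) has_real_derivative flat_exp (k + 2) s - real k * flat_exp (k + 1) s) (at s)"
    proof (cases k)
      case 0
      then show ?thesis
        using 1 by (auto intro!: derivative_eq_intros simp: flat_exp_def field_simps power2_eq_square)
    next
      case (Suc n)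
      then show ?thesis
        using 1 by (auto intro!: derivative_eq_intros simp: flat_exp_def field_simps power2_eq_square)
          (metis One_nat_def power_eq_if)
    qed
    then show ?thesis
      by (rule has_field_derivative_transform_within_open[where S = "{0<..}"]) (use 1 in \<open>auto simp: flat_exp_def\<close>)
  next
    case 2
    have "((\<lambda>s. 0) has_real_derivative flat_exp (k + 2) s - real k * flat_exp (k + 1) s) (at s)"
      using 2 by (auto simp: flat_exp_def)
    then show ?thesis
      by (rule has_field_derivative_transform_within_open[where S = "{..<0}"]) (use 2 in \<open>auto simp: flat_exp_def\<close>)
  next
    case 3
    have "((\<lambda>h. inverse h ^ (k + 1) / exp (inverse h)) \<longlongrightarrow> (0::real)) (at_right 0)"
      by (rule filterlim_compose[OF tendsto_power_div_exp_0 filterlim_inverse_at_top_right])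
    then have "((\<lambda>h. flat_exp k h / h) \<longlongrightarrow> 0) (at_right 0)"
    proof (rule Lim_transform_eventually)
      show "\<forall>\<^sub>F h in at_right 0. inverse h ^ (k + 1) / exp (inverse h) = flat_exp k h / h"
        by (auto simp: eventually_at_right_less flat_exp_def field_simps exp_minus
            intro!: eventually_mono[OF eventually_at_right_less[of 0]])
    qed
    moreover have "((\<lambda>h. flat_exp k h / h) \<longlongrightarrow> 0) (at_left 0)"
      by (rule tendsto_eventually, rule eventually_at_leftI[of "-1"]) (auto simp: flat_exp_def)
    ultimately have "((\<lambda>h. flat_exp k h / h) \<longlongrightarrow> 0) (at 0)"
      by (rule filterlim_split_at[rotated])
    then show ?thesis
      using 3 by (simp add: has_field_derivative_iff flat_exp_def)
  qed
qed

text \<open>For \<open>p = 1\<close> this is a smooth function that is positive exactly where \<open>w\<close> is. All derivatives have the form \<open>q x * flat_exp j (w x)\<close> with a polynomial \<open>q\<close>: the terms of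
  the product rule have different \<open>j\<close>, and \<open>flat_exp_shift\<close> brings them to the largest one.\<close>

lemma smooth_poly_flat_exp: "smooth (\<lambda>x. poly p x * flat_exp k (poly w x))"
proof (rule smooth_coinduct[where P = "\<lambda>f. \<exists>p k. f = (\<lambda>x. poly p x * flat_exp k (poly w x))"])
  fix f assume "\<exists>p k. f = (\<lambda>x. poly p x * flat_exp k (poly w x))"
  then obtain p k where f: "f = (\<lambda>x. poly p x * flat_exp k (poly w x))" by blast
  define q where "q = pderiv p * w ^ 2 + p * pderiv w - smult (real k) (p * pderiv w * w)"
  have "(f has_real_derivative poly q x * flat_exp (k + 2) (poly w x)) (at x)" for x
  proof -
    have "(f has_real_derivative poly (pderiv p) x * flat_exp k (poly w x) +
        poly p x * ((flat_exp (k + 2) (poly w x) - real k * flat_exp (k + 1) (poly w x)) * poly (pderiv w) x)) (at x)"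
      unfolding f
      by (auto intro!: derivative_eq_intros DERIV_chain'[OF _ flat_exp_has_derivative] poly_DERIV)
    also have "poly (pderiv p) x * flat_exp k (poly w x) +
        poly p x * ((flat_exp (k + 2) (poly w x) - real k * flat_exp (k + 1) (poly w x)) * poly (pderiv w) x)
      = poly q x * flat_exp (k + 2) (poly w x)"
      using flat_exp_shift[of k "poly w x" 2] flat_exp_shift[of "k + 1" "poly w x" 1]
      by (simp add: q_def algebra_simps numeral_eq_Suc)
    finally show ?thesis .
  qed
  then show "\<exists>g'. (\<exists>p k. g' = (\<lambda>x. poly p x * flat_exp k (poly w x))) \<and>
      (\<forall>x. (f has_real_derivative g' x) (at x))"
    by (intro exI[of _ "\<lambda>x. poly q x * flat_exp (k + 2) (poly w x)"]) blast
qed blast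

text \<open>The bump functions \<open>exp (- 1 / (n * (x - a) * (b - x)))\<close> on the open interval from \<open>a\<close> to \<open>b\<close>,
  continued by 0, are test functions and tend to the
  indicator function of this interval as \<open>n\<close> tends to infinity.\<close>

lemma real_distribution_eqI_Cc_infty:
  assumes \<mu>: "real_distribution \<mu>" and \<nu>: "real_distribution \<nu>"
    and eq: "\<And>F. F \<in> Cc_infty \<Longrightarrow> (\<integral>x. F x \<partial>\<mu>) = (\<integral>x. F x \<partial>\<nu>)"
  shows "\<mu> = \<nu>"
proof -
  define w where "w a b = [:-a, 1:] * [:b, -1:]" for a b :: real
  define \<phi> where "\<phi> a b n x = flat_exp 0 (real n * poly (w a b) x)" for a b n x
  have w: "poly (w a b) x > 0 \<longleftrightarrow> x \<in> {a<..<b}" if "a < b" for a b x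
  proof -
    have "poly (w a b) x = (x - a) * (b - x)" by (simp add: w_def algebra_simps)
    then show ?thesis using that by (auto simp: zero_less_mult_iff)
  qed
  have Cc: "\<phi> a b n \<in> Cc_infty" if "a < b" for a b n
  proof -
    have "smooth (\<phi> a b n)"
      using smooth_poly_flat_exp[of 1 0 "smult (real n) (w a b)"] by (simp add: \<phi>_def[abs_def])
    moreover have "\<phi> a b n x = 0" if "\<bar>x\<bar> > \<bar>a\<bar> + \<bar>b\<bar>" for x
      using w[OF \<open>a < b\<close>, of x] that
      by (auto simp: \<phi>_def flat_exp_def zero_less_mult_iff)
    ultimately show ?thesis unfolding Cc_infty_iff by blast
  qed
  have lim: "(\<lambda>n. \<phi> a b n x) \<longlonglongrightarrow> indicator {a<..<b} x" if "a < b" for a b x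
  proof (cases "x \<in> {a<..<b}")
    case True
    let ?s = "poly (w a b) x"
    have s: "?s > 0" using True w[OF that] by simp
    have "(\<lambda>n. exp (- (1 / ?s) * inverse (real n))) \<longlonglongrightarrow> exp (- (1 / ?s) * 0)"
      by (intro tendsto_intros lim_inverse_n)
    then have "(\<lambda>n. exp (- (1 / ?s) * inverse (real n))) \<longlonglongrightarrow> 1" by simp
    then have "(\<lambda>n. \<phi> a b n x) \<longlonglongrightarrow> 1"
      by (rule Lim_transform_eventually)
        (use s in \<open>auto simp: \<phi>_def flat_exp_def field_simps intro!: eventually_mono[OF eventually_gt_at_top[of 0]]\<close>)
    then show ?thesis using True by simp
  next
    case False
    then have "\<not> poly (w a b) x > 0" using w[OF that, of x] by blast
    then have "\<phi> a b n x = 0" for n by (auto simp: \<phi>_def flat_exp_def zero_less_mult_iff)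
    then show ?thesis using False by simp
  qed
  have bound: "\<bar>\<phi> a b n x\<bar> \<le> 1" for a b n x
    by (auto simp: \<phi>_def flat_exp_def)
  have int: "(\<lambda>n. \<integral>x. \<phi> a b n x \<partial>M) \<longlonglongrightarrow> measure M {a<..<b}"
    if "real_distribution M" "a < b" for M a b
  proof -
    interpret real_distribution M by fact
    have [measurable]: "\<phi> a b n \<in> borel_measurable borel" for n
      using Cc[OF that(2)] smooth_borel unfolding Cc_infty_iff by blast
    have "(\<lambda>n. \<integral>x. \<phi> a b n x \<partial>M) \<longlonglongrightarrow> (\<integral>x. indicator {a<..<b} x \<partial>M)"
      by (intro integral_dominated_convergence[where w = "\<lambda>_. 1"])
        (auto simp: lim[OF that(2)] bound)
    then show ?thesis by simp
  qed
  have ioo: "measure \<mu> {a<..<b} = measure \<nu> {a<..<b}" if "a < b" for a b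
    using int[OF \<mu> that] int[OF \<nu> that] eq[OF Cc[OF that]] LIMSEQ_unique by simp
  have lim2: "(\<lambda>n. measure M {a<..<a + real (Suc n)}) \<longlonglongrightarrow> measure M {a<..}"
    if "real_distribution M" for M a
  proof -
    interpret real_distribution M by fact
    have "(\<Union>n. {a<..<a + real (Suc n)}) = {a<..}"
    proof safe
      fix x assume "a < x"
      obtain n where "x - a < real n" using reals_Archimedean2 by blast
      then show "x \<in> (\<Union>n. {a<..<a + real (Suc n)})" using \<open>a < x\<close> by (auto intro!: exI[of _ n])
    qed auto
    moreover have "incseq (\<lambda>n. {a<..<a + real (Suc n)})"
      by (rule incseq_SucI) auto
    ultimately show ?thesis
      using finite_Lim_measure_incseq[of "\<lambda>n. {a<..<a + real (Suc n)}"]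
      by (simp add: image_subset_iff)
  qed
  have meas: "measure \<mu> {a<..} = measure \<nu> {a<..}" for a
    using lim2[OF \<mu>, of a] lim2[OF \<nu>, of a] LIMSEQ_unique by (simp add: ioo)
  interpret \<mu>: real_distribution \<mu> by fact
  interpret \<nu>: real_distribution \<nu> by fact
  show ?thesis
    by (rule measure_eqI_lessThan)
      (use meas in \<open>auto simp: \<mu>.emeasure_eq_measure \<nu>.emeasure_eq_measure\<close>)
qed

lemma real_distribution_eqI_funpow_deriv:
  assumes \<mu>: "real_distribution \<mu>" and \<nu>: "real_distribution \<nu>"
    and "\<And>F. F \<in> Cc_infty \<Longrightarrow> (\<integral>x. (deriv ^^ k) F x \<partial>\<mu>) = (\<integral>x. (deriv ^^ k) F x \<partial>\<nu>)"
  shows "\<mu> = \<nu>"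
  using assms(3)
proof (induction k)
  case 0
  then show ?case using real_distribution_eqI_Cc_infty[OF \<mu> \<nu>] by simp
next
  case (Suc k)
  then show ?case using integral_deriv_descent[OF \<mu> \<nu>] by blast
qed

section \<open>The Rodrigues formula and integration by parts\<close>

text \<open>The operator on polynomials that corresponds to differentiation of
  \<open>p x * (1 - x\<^sup>2) powr b\<close>; the exponent \<open>b\<close> drops by one.\<close>

definition wderiv :: "real \<Rightarrow> real poly \<Rightarrow> real poly" where
  "wderiv b p = pderiv p * [:1, 0, -1:] - smult (2 * b) ([:0, 1:] * p)"

lemma weighted_poly_has_derivative:
  assumes "x \<in> {-1<..<1}"
  shows "((\<lambda>x. poly p x * (1 - x\<^sup>2) powr b) has_real_derivative
           poly (wderiv b p) x * (1 - x\<^sup>2) powr (b - 1)) (at x)"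
proof -
  have pos: "1 - x\<^sup>2 > 0" using assms by (simp add: abs_square_less_1 abs_less_iff)
  have "((\<lambda>x. poly p x * (1 - x\<^sup>2) powr b) has_real_derivative
           poly (pderiv p) x * (1 - x\<^sup>2) powr b + poly p x * (b * (1 - x\<^sup>2) powr (b - 1) * (- 2 * x))) (at x)"
    using pos by (auto intro!: derivative_eq_intros poly_DERIV)
  also have "(1 - x\<^sup>2) powr b = (1 - x\<^sup>2) powr (b - 1) * (1 - x\<^sup>2)"
    using pos powr_add[of "1 - x\<^sup>2" "b - 1" 1] by simp
  also have "poly (pderiv p) x * ((1 - x\<^sup>2) powr (b - 1) * (1 - x\<^sup>2)) + poly p x * (b * (1 - x\<^sup>2) powr (b - 1) * (- 2 * x))
     = poly (wderiv b p) x * (1 - x\<^sup>2) powr (b - 1)"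
    by (simp add: wderiv_def algebra_simps power2_eq_square)
  finally show ?thesis .
qed

primrec rodrigues_factor :: "real \<Rightarrow> nat \<Rightarrow> real poly" where
  "rodrigues_factor a 0 = 1"
| "rodrigues_factor a (Suc k) = wderiv (a - real k) (rodrigues_factor a k)"

lemma funpow_deriv_weight:
  assumes "x \<in> {-1<..<1}"
  shows "(deriv ^^ k) (\<lambda>y. (1 - y\<^sup>2) powr a) x = poly (rodrigues_factor a k) x * (1 - x\<^sup>2) powr (a - real k)"
  using assms
proof (induction k arbitrary: x)
  case 0
  then show ?case by simp
next
  case (Suc k)
  have "((deriv ^^ k) (\<lambda>y. (1 - y\<^sup>2) powr a) has_real_derivative
      poly (wderiv (a - real k) (rodrigues_factor a k)) x * (1 - x\<^sup>2) powr (a - real k - 1)) (at x)"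
    by (rule has_field_derivative_transform_within_open[OF weighted_poly_has_derivative[OF Suc.prems],
          where S = "{-1<..<1}"]) (use Suc in auto)
  then show ?case
    by (simp add: DERIV_imp_deriv algebra_simps)
qed

lemma set_integrable_continuous_times:
  fixes g w :: "real \<Rightarrow> real"
  assumes g: "continuous_on UNIV g" and w: "set_integrable lborel {-1<..<1} w"
  shows "set_integrable lborel {-1<..<1} (\<lambda>x. g x * w x)"
proof -
  have "compact (g ` {-1..1})"
    by (intro compact_continuous_image continuous_on_subset[OF g]) auto
  then obtain B where "\<forall>y\<in>g ` {-1..1}. norm y \<le> B"
    using compact_imp_bounded[of "g ` {-1..1}"] unfolding bounded_iff by blast
  then have B: "\<bar>g x\<bar> \<le> B" if "x \<in> {-1<..<1}" for x
    using that by auto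
  have [measurable]: "g \<in> borel_measurable borel" by (rule borel_measurable_continuous_onI[OF g])
  have w': "integrable lborel (\<lambda>x. indicator {-1<..<1} x * w x)"
    using w by (simp add: set_integrable_def)
  have m: "(\<lambda>x. g x * (indicator {-1<..<1} x * w x)) \<in> borel_measurable lborel"
    using borel_measurable_integrable[OF w'] by measurable
  have "integrable lborel (\<lambda>x. g x * (indicator {-1<..<1} x * w x))"
  proof (rule Bochner_Integration.integrable_bound[OF integrable_mult_right[OF w', of B] m], intro AE_I2)
    fix x
    show "norm (g x * (indicator {-1<..<1} x * w x)) \<le> norm (B * (indicator {-1<..<1} x * w x))"
      using B[of x] by (auto simp: abs_mult indicator_def intro!: mult_right_mono)
  qed
  then show ?thesis by (simp add: set_integrable_def mult_ac)
qed

lemma weighted_integration_by_parts: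
  assumes b: "b > 0" and f: "smooth f"
    and int: "set_integrable lborel {-1<..<1} (\<lambda>x. (1 - x\<^sup>2) powr (b - 1))"
  shows "(LINT x:{-1<..<1}|lborel. f x * poly (wderiv b p) x * (1 - x\<^sup>2) powr (b - 1)) =
         - (LINT x:{-1<..<1}|lborel. deriv f x * poly p x * (1 - x\<^sup>2) powr b)"
proof -
  define u where "u x = f x * poly (wderiv b p) x * (1 - x\<^sup>2) powr (b - 1)" for x
  define v where "v x = deriv f x * poly p x * (1 - x\<^sup>2) powr b" for x
  define H where "H x = f x * (poly p x * (1 - x\<^sup>2) powr b)" for x
  note cont = smooth_imp_continuous[OF f] smooth_imp_continuous[OF smooth_deriv[OF f]]
  have pos: "1 - x\<^sup>2 > 0" if "x \<in> {-1<..<1}" for x :: real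
    using that by (simp add: abs_square_less_1 abs_less_iff)
  have u: "set_integrable lborel {-1<..<1} u"
    unfolding u_def by (intro set_integrable_continuous_times int continuous_intros cont)
  have "set_integrable lborel {-1<..<1} (\<lambda>x. (deriv f x * poly p x * (1 - x\<^sup>2)) * (1 - x\<^sup>2) powr (b - 1))"
    by (intro set_integrable_continuous_times int continuous_intros cont)
  also have "?this \<longleftrightarrow> set_integrable lborel {-1<..<1} v"
  proof (rule set_integrable_cong)
    fix x :: real assume "x \<in> {-1<..<1}"
    then show "(deriv f x * poly p x * (1 - x\<^sup>2)) * (1 - x\<^sup>2) powr (b - 1) = v x"
      using pos[of x] powr_add[of "1 - x\<^sup>2" "b - 1" 1] by (simp add: v_def)
  qed auto
  finally have v: "set_integrable lborel {-1<..<1} v" .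
  have "(LBINT x=ereal (-1)..ereal 1. v x + u x) = 0 - 0"
  proof (rule interval_integral_FTC_integrable[where F = H])
    fix x assume "ereal (-1) < ereal x" "ereal x < ereal 1"
    then have x: "x \<in> {-1<..<1}" by simp
    have "(H has_real_derivative v x + u x) (at x)"
      unfolding H_def
      using DERIV_mult[OF smooth_has_deriv[OF f, of x] weighted_poly_has_derivative[OF x, of p b]]
      by (simp add: u_def v_def algebra_simps)
    then show "(H has_vector_derivative v x + u x) (at x)"
      by (simp add: has_real_derivative_iff_has_vector_derivative)
    show "isCont (\<lambda>x. v x + u x) x"
      unfolding u_def v_def
      using smooth_isCont[OF f] smooth_isCont[OF smooth_deriv[OF f]] pos[OF x]
      by (intro continuous_intros) auto
  next
    (* the factor with positive exponent b vanishes at both end points *)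
    have lim: "(H \<longlongrightarrow> 0) (at c within {-1..1})" if "c\<^sup>2 = 1" for c
    proof -
      have "((\<lambda>x. (1 - x\<^sup>2) powr b) \<longlongrightarrow> (1 - c\<^sup>2) powr b) (at c within {-1..1})"
      proof (rule tendsto_powr')
        show "1 - c\<^sup>2 \<noteq> 0 \<or> 0 < b \<and> (\<forall>\<^sub>F x in at c within {-1..1}. 0 \<le> 1 - x\<^sup>2)"
          using b by (auto simp: eventually_at_filter abs_square_le_1 abs_le_iff intro!: always_eventually)
      qed (auto intro!: tendsto_intros)
      moreover have "(f \<longlongrightarrow> f c) (at c within {-1..1})"
        using smooth_isCont[OF f] by (simp add: continuous_at_imp_continuous_within continuous_within[symmetric])
      ultimately have "(H \<longlongrightarrow> f c * (poly p c * (1 - c\<^sup>2) powr b)) (at c within {-1..1})"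
        unfolding H_def by (intro tendsto_mult tendsto_poly tendsto_ident_at)
      then show ?thesis using that by simp
    qed
    show "((H \<circ> real_of_ereal) \<longlongrightarrow> 0) (at_right (ereal (-1)))"
      using lim[of "-1"] by (simp add: ereal_tendsto_simps1 at_within_Icc_at_right)
    show "((H \<circ> real_of_ereal) \<longlongrightarrow> 0) (at_left (ereal 1))"
      using lim[of 1] by (simp add: ereal_tendsto_simps1 at_within_Icc_at_left)
    show "set_integrable lborel (einterval (ereal (-1)) (ereal 1)) (\<lambda>x. v x + u x)"
      using set_integral_add(1)[OF v u] by simp
  qed simp
  then have "(LINT x:{-1<..<1}|lborel. v x + u x) = 0"
    by (simp add: interval_lebesgue_integral_le_eq)
  then have "(LINT x:{-1<..<1}|lborel. u x) = - (LINT x:{-1<..<1}|lborel. v x)"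
    using set_integral_add(2)[OF v u] by simp
  then show ?thesis by (simp add: u_def v_def)
qed

text \<open>The exponent \<open>c + k\<close> of the function that is differentiated grows with \<open>k\<close>, while the exponent
  \<open>c\<close> of the resulting weight is fixed. The outermost derivative is moved to \<open>f\<close> first, and the
  induction hypothesis is then used for \<open>c + 1\<close> and \<open>deriv f\<close>.\<close>

lemma weighted_integral_rodrigues_factor:
  assumes "c > -1" and "smooth f"
    and "set_integrable lborel {-1<..<1} (\<lambda>x. (1 - x\<^sup>2) powr c)"
  shows "(LINT x:{-1<..<1}|lborel. f x * poly (rodrigues_factor (c + real k) k) x * (1 - x\<^sup>2) powr c) =
         (-1) ^ k * (LINT x:{-1<..<1}|lborel. (deriv ^^ k) f x * (1 - x\<^sup>2) powr (c + real k))"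
  using assms
proof (induction k arbitrary: c f)
  case 0
  then show ?case by simp
next
  case (Suc k)
  have "set_integrable lborel {-1<..<1} (\<lambda>x. (1 - x\<^sup>2) * (1 - x\<^sup>2) powr c)"
    by (intro set_integrable_continuous_times Suc.prems continuous_intros)
  also have "?this \<longleftrightarrow> set_integrable lborel {-1<..<1} (\<lambda>x. (1 - x\<^sup>2) powr (c + 1))"
  proof (rule set_integrable_cong)
    fix x :: real assume "x \<in> {-1<..<1}"
    then have "1 - x\<^sup>2 > 0" by (simp add: abs_square_less_1 abs_less_iff)
    then show "(1 - x\<^sup>2) * (1 - x\<^sup>2) powr c = (1 - x\<^sup>2) powr (c + 1)"
      by (simp add: powr_add)
  qed auto
  finally have int: "set_integrable lborel {-1<..<1} (\<lambda>x. (1 - x\<^sup>2) powr (c + 1))" .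
  have "(LINT x:{-1<..<1}|lborel. f x * poly (rodrigues_factor (c + real (Suc k)) (Suc k)) x * (1 - x\<^sup>2) powr c) =
    - (LINT x:{-1<..<1}|lborel. deriv f x * poly (rodrigues_factor (c + 1 + real k) k) x * (1 - x\<^sup>2) powr (c + 1))"
    using weighted_integration_by_parts[of "c + 1" f "rodrigues_factor (c + real (Suc k)) k"] Suc.prems
    by (simp add: add_ac)
  also have "\<dots> = - ((-1) ^ k * (LINT x:{-1<..<1}|lborel. (deriv ^^ k) (deriv f) x * (1 - x\<^sup>2) powr (c + 1 + real k)))"
    using Suc.prems by (subst Suc.IH) (auto intro: smooth_deriv int)
  finally show ?case
    by (simp add: funpow_swap1 add_ac)
qed

section \<open>The Gegenbauer distributions\<close>

definition gegenbauer_const :: "real \<Rightarrow> real" where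
  "gegenbauer_const \<kappa> = 1 / sqrt pi * (Gamma (\<kappa> + 1) / Gamma (\<kappa> + 1/2))"

lemma gegenbauer_const_pos: "\<kappa> > - 1/2 \<Longrightarrow> gegenbauer_const \<kappa> > 0"
  by (simp add: gegenbauer_const_def Gamma_real_pos)

lemma gegenbauer_density_altdef:
  "gegenbauer_density \<kappa> x =
     gegenbauer_const \<kappa> * (indicator {-1<..<1} x * (1 - x\<^sup>2) powr (\<kappa> - 1/2))"
proof -
  have "1 - x\<^sup>2 = 0" if "\<bar>x\<bar> \<le> 1" "x \<notin> {-1<..<1}"
  proof -
    have "x = 1 \<or> x = -1" using that by auto
    then show ?thesis by auto
  qed
  then show ?thesis
    by (auto simp: gegenbauer_density_def gegenbauer_const_def indicator_def)
qed

lemma gegenbauer_density_nonneg: "\<kappa> > - 1/2 \<Longrightarrow> gegenbauer_density \<kappa> x \<ge> 0"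
  using gegenbauer_const_pos[of \<kappa>] by (simp add: gegenbauer_density_altdef)

lemma gegenbauer_density_borel [measurable]: "gegenbauer_density \<kappa> \<in> borel_measurable borel"
  unfolding gegenbauer_density_altdef[abs_def] by measurable

lemma
  assumes "\<kappa> > - 1/2" and [measurable]: "h \<in> borel_measurable borel"
  shows gegenbauer_integral: "(\<integral>x. h x \<partial>gegenbauer_distr \<kappa>) =
      gegenbauer_const \<kappa> * (LINT x:{-1<..<1}|lborel. h x * (1 - x\<^sup>2) powr (\<kappa> - 1/2))"
    and gegenbauer_integrable_iff: "integrable (gegenbauer_distr \<kappa>) h \<longleftrightarrow>
      set_integrable lborel {-1<..<1} (\<lambda>x. h x * (1 - x\<^sup>2) powr (\<kappa> - 1/2))"
proof -
  note nn = gegenbauer_density_nonneg[OF assms(1)] gegenbauer_const_pos[OF assms(1)]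
  have eq: "gegenbauer_density \<kappa> x * h x =
      gegenbauer_const \<kappa> * (indicator {-1<..<1} x * (h x * (1 - x\<^sup>2) powr (\<kappa> - 1/2)))" for x
    by (simp add: gegenbauer_density_altdef)
  show "(\<integral>x. h x \<partial>gegenbauer_distr \<kappa>) =
      gegenbauer_const \<kappa> * (LINT x:{-1<..<1}|lborel. h x * (1 - x\<^sup>2) powr (\<kappa> - 1/2))"
    unfolding gegenbauer_distr_def
    by (subst integral_real_density) (auto simp: nn eq set_lebesgue_integral_def)
  show "integrable (gegenbauer_distr \<kappa>) h \<longleftrightarrow>
      set_integrable lborel {-1<..<1} (\<lambda>x. h x * (1 - x\<^sup>2) powr (\<kappa> - 1/2))"
    unfolding gegenbauer_distr_def
    using nn by (subst integrable_real_density) (auto simp: eq set_integrable_def)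
qed

text \<open>A total mass of 1 already contains the integrability of the weight, which for negative
  exponents \<open>\<kappa> - 1/2\<close> is unbounded at the end points.\<close>

lemma weight_set_integrable:
  assumes "\<kappa> > - 1/2" "prob_space (gegenbauer_distr \<kappa>)"
  shows "set_integrable lborel {-1<..<1} (\<lambda>x. (1 - x\<^sup>2) powr (\<kappa> - 1/2))"
proof -
  interpret prob_space "gegenbauer_distr \<kappa>" by fact
  have "integrable (gegenbauer_distr \<kappa>) (\<lambda>x. 1)" by simp
  then show ?thesis using gegenbauer_integrable_iff[OF assms(1), of "\<lambda>x. 1"] by simp
qed

text \<open>The factor \<open>(1 - x\<^sup>2) powr (1/2 - l)\<close> cancels the power that is left by \<open>m\<close> differentiations, and
  a polynomial is determined by its values on an infinite set.\<close>

lemma gegenbauer_poly_eq: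
  "gegenbauer_poly l m = smult ((-1) ^ m * gegenbauer_alpha l m *
     ((Gamma (l + 1/2) * Gamma (l + real m + 1)) / (Gamma (l + 1) * Gamma (l + real m + 1/2))))
     (rodrigues_factor (l + real m - 1/2) m)" (is "_ = ?p")
proof -
  have p: "poly ?p x = gegenbauer_rodrigues l m x" if x: "x \<in> {-1<..<1}" for x
  proof -
    have pos: "1 - x\<^sup>2 > 0" using x by (simp add: abs_square_less_1 abs_less_iff)
    have "(1 - x\<^sup>2) powr (1/2 - l) * (1 - x\<^sup>2) powr (l + real m - 1/2 - real m) = 1"
      using pos by (simp add: powr_add[symmetric])
    then show ?thesis
      by (simp add: gegenbauer_rodrigues_def funpow_deriv_weight[OF x] mult_ac)
  qed
  show ?thesis
    unfolding gegenbauer_poly_def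
  proof (rule the_equality)
    fix q assume q: "\<forall>x\<in>{-1<..<1}. poly q x = gegenbauer_rodrigues l m x"
    have "{-1<..<1} \<subseteq> {x. poly (q - ?p) x = 0}" using p q by auto
    moreover have "infinite {-1<..<(1::real)}" by simp
    ultimately have "q - ?p = 0" using poly_roots_finite finite_subset by blast
    then show "q = ?p" by simp
  qed (use p in blast)
qed

text \<open>The constant in the Rodrigues formula is, apart from sign and \<open>gegenbauer_alpha l m\<close>, the quotient
  \<open>gegenbauer_const (l + m) / gegenbauer_const l\<close>.\<close>

lemma gegenbauer_integral_identity:
  assumes l: "l > - 1/2" and P: "prob_space (gegenbauer_distr l)" and F: "smooth F"
  shows "(\<integral>x. poly (gegenbauer_poly l m) x * F x \<partial>gegenbauer_distr l) =
    gegenbauer_alpha l m * (\<integral>x. (deriv ^^ m) F x \<partial>gegenbauer_distr (l + real m))"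
proof -
  let ?K = "(Gamma (l + 1/2) * Gamma (l + real m + 1)) / (Gamma (l + 1) * Gamma (l + real m + 1/2))"
  let ?c = "(-1) ^ m * gegenbauer_alpha l m * ?K"
  let ?r = "rodrigues_factor (l + real m - 1/2) m"
  have [measurable]: "F \<in> borel_measurable borel" "(deriv ^^ m) F \<in> borel_measurable borel"
    using F smooth_funpow_deriv smooth_borel by blast+
  have [measurable]: "poly p \<in> borel_measurable borel" for p :: "real poly"
    by (intro borel_measurable_continuous_onI continuous_intros)
  have Gpos: "Gamma (l + 1) > 0" "Gamma (l + 1/2) > 0"
    using l by (auto intro!: Gamma_real_pos)
  have sgn: "(-1) ^ m * (-1) ^ m = (1::real)" by (simp flip: power_mult_distrib)
  have K: "gegenbauer_const l * ?K = gegenbauer_const (l + real m)"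
    using Gpos by (simp add: gegenbauer_const_def add_ac)
  have "(\<integral>x. poly (gegenbauer_poly l m) x * F x \<partial>gegenbauer_distr l) =
      gegenbauer_const l * (LINT x:{-1<..<1}|lborel. ?c * (F x * poly ?r x * (1 - x\<^sup>2) powr (l - 1/2)))"
    by (subst gegenbauer_integral[OF l]) (auto simp: gegenbauer_poly_eq mult_ac)
  also have "\<dots> = gegenbauer_const l * (?c * (LINT x:{-1<..<1}|lborel. F x * poly ?r x * (1 - x\<^sup>2) powr (l - 1/2)))"
    by (simp only: set_integral_mult_right)
  also have "(LINT x:{-1<..<1}|lborel. F x * poly ?r x * (1 - x\<^sup>2) powr (l - 1/2)) =
      (-1) ^ m * (LINT x:{-1<..<1}|lborel. (deriv ^^ m) F x * (1 - x\<^sup>2) powr (l + real m - 1/2))"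
    using weighted_integral_rodrigues_factor[OF _ F weight_set_integrable[OF l P], of m] l
    by (simp add: algebra_simps)
  also have "gegenbauer_const l * (?c * ((-1) ^ m * (LINT x:{-1<..<1}|lborel. (deriv ^^ m) F x * (1 - x\<^sup>2) powr (l + real m - 1/2))))
     = ((-1) ^ m * (-1) ^ m) * gegenbauer_alpha l m * ((gegenbauer_const l * ?K) * (LINT x:{-1<..<1}|lborel. (deriv ^^ m) F x * (1 - x\<^sup>2) powr (l + real m - 1/2)))"
    by (simp only: mult_ac)
  also have "\<dots> = gegenbauer_alpha l m * (\<integral>x. (deriv ^^ m) F x \<partial>gegenbauer_distr (l + real m))"
    using l by (subst gegenbauer_integral) (simp_all only: K sgn, simp_all)
  finally show ?thesis .
qed

section \<open>The normalising constant\<close>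

lemma smooth_poly: "smooth (poly p)"
proof (rule smooth_coinduct[where P = "\<lambda>f. \<exists>p. f = poly p"])
  show "\<exists>g'. (\<exists>p. g' = poly p) \<and> (\<forall>x. (g has_real_derivative g' x) (at x))"
    if "\<exists>p. g = poly p" for g
    using that poly_DERIV by blast
qed blast

lemma funpow_deriv_monom: "(deriv ^^ k) (\<lambda>x::real. c * x ^ k) = (\<lambda>x. c * fact k)"
proof (induction k arbitrary: c)
  case 0
  then show ?case by simp
next
  case (Suc k)
  have "deriv (\<lambda>x. c * x ^ Suc k) = (\<lambda>x::real. (c * real (Suc k)) * x ^ k)"
  proof (intro ext DERIV_imp_deriv)
    fix x
    show "((\<lambda>x. c * x ^ Suc k) has_real_derivative c * real (Suc k) * x ^ k) (at x)"
      using DERIV_cmult[OF DERIV_pow[of "Suc k" x], of c] by (simp add: mult.assoc)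
  qed
  then show ?case using Suc[of "c * real (Suc k)"]
    by (simp only: funpow_Suc_right comp_apply) (simp add: algebra_simps)
qed

text \<open>The case \<open>F x = x ^ m\<close> of the integral identity.\<close>

lemma gegenbauer_alpha_eq_moment:
  assumes l: "l > - 1/2" and P: "prob_space (gegenbauer_distr l)"
    and P': "prob_space (gegenbauer_distr (l + real m))"
  shows "1 / fact m * (\<integral>x. x ^ m * poly (gegenbauer_poly l m) x \<partial>gegenbauer_distr l) = gegenbauer_alpha l m"
proof -
  interpret P': prob_space "gegenbauer_distr (l + real m)" by fact
  have "smooth (\<lambda>x. x ^ m)"
    using smooth_poly[of "monom 1 m"] by (simp add: poly_monom[abs_def])
  from gegenbauer_integral_identity[OF l P this, of m] show ?thesis
    using funpow_deriv_monom[of m 1] P'.prob_space by (simp add: mult.commute)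
qed

lemma Gamma_nonzero: 
  fixes x :: real
  assumes "x > -1" "x \<noteq> 0" shows "Gamma x \<noteq> 0"
proof -
  have "x \<notin> \<int>\<^sub>\<le>\<^sub>0"
  proof
    assume "x \<in> \<int>\<^sub>\<le>\<^sub>0"
    then obtain n where "x = - real n" by (rule nonpos_Ints_cases')
    then show False using assms by (cases n) auto
  qed
  then show ?thesis by (simp add: Gamma_eq_zero_iff)
qed

text \<open>For \<open>m > 0\<close> the only factors with a pole at 0 are \<open>Gamma l\<close> and \<open>Gamma (2 * l)\<close>, and the
  functional equation turns their quotient into \<open>2 * Gamma (l + 1) / Gamma (2 * l + 1)\<close>.\<close>

lemma gegenbauer_alpha_zero_tendsto:
  assumes "m > 0"
  shows "(gegenbauer_alpha_quot m \<longlongrightarrow> 2 * Gamma (real m) / (2 ^ (2 * m) * Gamma (real m + 1) * Gamma (real m))) (at 0)"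
proof -
  define h where "h l = (2 * Gamma (l + 1) * Gamma (2 * l + real m) * Gamma (l + 1)) /
     (2 ^ (2 * m) * Gamma (l + real m + 1) * Gamma (l + real m) * Gamma (2 * l + 1))" for l :: real
  have G1: "Gamma (l + 1) = l * Gamma l" if "l > -1" "l \<noteq> 0" for l :: real
    using Gamma_nonzero[OF that] by (intro Gamma_plus1) (auto simp: Gamma_eq_zero_iff)
  have eq: "h l = gegenbauer_alpha_quot m l" if "\<bar>l\<bar> < 1/2" "l \<noteq> 0" for l
  proof -
    have Gamma: "Gamma l = Gamma (l + 1) / l" "Gamma (2 * l + 1) = 2 * l * Gamma (2 * l)"
      using that G1[of l] G1[of "2 * l"] by auto
    have "(2 * g * x * g) / (p * y * w * (2 * l * d)) = ((g / l) * x * g) / (p * y * w * d)" for g x p y w d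
      using that by (simp add: mult_ac)
    then show ?thesis
      by (simp only: h_def gegenbauer_alpha_quot_def Gamma)
  qed
  have nn: "x \<notin> \<int>\<^sub>\<le>\<^sub>0" if "x > 0" for x :: real using that by auto
  have "(h \<longlongrightarrow> h 0) (at 0)"
    unfolding h_def
    using Gamma_nonzero[of "real m"] Gamma_nonzero[of "real m + 1"] assms
    by (intro tendsto_intros nn) (auto simp: nn)
  moreover have "\<forall>\<^sub>F l in at 0. h l = gegenbauer_alpha_quot m l"
    unfolding eventually_at by (intro exI[of _ "1/2"]) (auto simp: eq)
  ultimately have "(gegenbauer_alpha_quot m \<longlongrightarrow> h 0) (at 0)"
    by (rule Lim_transform_eventually)
  then show ?thesis by (simp add: h_def add_ac)
qed

text \<open>Away from \<open>l = 0\<close> no argument of a Gamma function is a pole. At \<open>l = 0\<close> and \<open>m = 0\<close> all factors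
  of the quotient cancel, so the limit is 1.\<close>

lemma gegenbauer_alpha_nonzero:
  assumes "l > - 1/2"
  shows "gegenbauer_alpha l m \<noteq> 0"
proof -
  have quot: "gegenbauer_alpha_quot m l \<noteq> 0" if "l > - 1/2" "l \<noteq> 0" for l
    using that unfolding gegenbauer_alpha_quot_def
    by (cases m) (auto intro!: Gamma_nonzero simp: Gamma_nonzero)
  show ?thesis
  proof (cases "l = 0")
    case False
    then show ?thesis using quot assms by (simp add: gegenbauer_alpha_def)
  next
    case True
    show ?thesis
    proof (cases "m = 0")
      case False
      then have "Lim (at 0) (gegenbauer_alpha_quot m) = 2 * Gamma (real m) / (2 ^ (2 * m) * Gamma (real m + 1) * Gamma (real m))"
        by (intro tendsto_Lim gegenbauer_alpha_zero_tendsto) auto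
      then show ?thesis
        using True False Gamma_nonzero[of "real m"] Gamma_nonzero[of "real m + 1"]
        by (simp add: gegenbauer_alpha_def)
    next
      case m: True
      have "\<forall>\<^sub>F l in at 0. 1 = gegenbauer_alpha_quot 0 l"
        unfolding eventually_at
        by (intro exI[of _ "1/2"]) (auto simp: gegenbauer_alpha_quot_def Gamma_nonzero dist_real_def)
      then have "(gegenbauer_alpha_quot 0 \<longlongrightarrow> 1) (at 0)"
        by (rule Lim_transform_eventually[OF tendsto_const])
      then have "Lim (at 0) (gegenbauer_alpha_quot 0) = 1" by (intro tendsto_Lim) auto
      then show ?thesis using True m by (simp add: gegenbauer_alpha_def)
    qed
  qed
qed

section \<open>The biased distribution\<close>

lemma real_distribution_gegenbauer:
  "prob_space (gegenbauer_distr \<kappa>) \<Longrightarrow> real_distribution (gegenbauer_distr \<kappa>)"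
  by (simp add: real_distribution_def real_distribution_axioms_def gegenbauer_distr_def)

lemma gegenbauer_distr_biased:
  assumes l: "l > - 1/2" and P: "prob_space (gegenbauer_distr l)"
    and P': "prob_space (gegenbauer_distr (l + real m))"
  shows "is_gegenbauer_biased l m (gegenbauer_distr l) (gegenbauer_distr (l + real m))"
proof -
  have "integrable (gegenbauer_distr l) (\<lambda>x. x ^ k)" for k
    by (subst gegenbauer_integrable_iff[OF l])
      (auto intro!: set_integrable_continuous_times weight_set_integrable l P continuous_intros)
  then show ?thesis
    using P P' gegenbauer_integral_identity[OF l P] gegenbauer_alpha_eq_moment[OF l P P']
    by (simp add: is_gegenbauer_biased_def moments_agree_def real_distribution_gegenbauer Cc_infty_iff)
qed

text \<open>Dividing the defining equation by the constant, which is not 0, leaves the integrals of \<open>m\<close>-th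
  derivatives, and these determine the measure.\<close>

lemma is_gegenbauer_biased_iff:
  assumes l: "l > - 1/2" and P: "prob_space (gegenbauer_distr l)"
    and P': "prob_space (gegenbauer_distr (l + real m))"
  shows "is_gegenbauer_biased l m (gegenbauer_distr l) \<nu> \<longleftrightarrow> \<nu> = gegenbauer_distr (l + real m)"
proof
  assume \<nu>: "is_gegenbauer_biased l m (gegenbauer_distr l) \<nu>"
  have "gegenbauer_alpha l m * (\<integral>x. (deriv ^^ m) F x \<partial>\<nu>) =
      gegenbauer_alpha l m * (\<integral>x. (deriv ^^ m) F x \<partial>gegenbauer_distr (l + real m))"
    if "F \<in> Cc_infty" for F
    using \<nu> gegenbauer_distr_biased[OF assms] that
    unfolding is_gegenbauer_biased_def gegenbauer_alpha_eq_moment[OF assms] by auto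
  then show "\<nu> = gegenbauer_distr (l + real m)"
    using \<nu> gegenbauer_alpha_nonzero[OF l] real_distribution_gegenbauer[OF P']
    by (intro real_distribution_eqI_funpow_deriv[of _ _ m]) (auto simp: is_gegenbauer_biased_def)
qed (use gegenbauer_distr_biased[OF assms] in simp)

theorem mainTheorem10:
  fixes l :: real and m :: nat
    and M :: "real \<Rightarrow> 'a measure" and Z :: "real \<Rightarrow> 'a \<Rightarrow> real"
  assumes l: "l > - 1/2"
    and M: "\<And>\<kappa>. \<kappa> > - 1/2 \<Longrightarrow> prob_space (M \<kappa>)"
    and Z: "\<And>\<kappa>. \<kappa> > - 1/2 \<Longrightarrow>
              distributed (M \<kappa>) lborel (Z \<kappa>) (\<lambda>x. ennreal (gegenbauer_density \<kappa> x))"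
  shows "(\<forall>F\<in>Cc_infty.
            (\<integral>\<omega>. poly (gegenbauer_poly l m) (Z l \<omega>) * F (Z l \<omega>) \<partial>M l) =
            gegenbauer_alpha l m *
              (\<integral>\<omega>. (deriv ^^ m) F (Z (l + real m) \<omega>) \<partial>M (l + real m))) \<and>
         (\<exists>!\<nu>. is_gegenbauer_biased l m (distr (M l) borel (Z l)) \<nu>) \<and>
         gegenbauer_biased l m (distr (M l) borel (Z l)) =
           distr (M (l + real m)) borel (Z (l + real m)) \<and>
         gegenbauer_biased l m (gegenbauer_distr l) = gegenbauer_distr (l + real m)"
proof -
  have lm: "l + real m > - 1/2" using l by simp
  have rv: "Z \<kappa> \<in> borel_measurable (M \<kappa>)" if "\<kappa> > - 1/2" for \<kappa>
    using distributed_measurable[OF Z[OF that]] by simp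
  have distr: "distr (M \<kappa>) borel (Z \<kappa>) = gegenbauer_distr \<kappa>" if "\<kappa> > - 1/2" for \<kappa>
    using distributed_distr_eq_density[OF Z[OF that]]
    by (simp add: gegenbauer_distr_def cong: distr_cong)
  have prob: "prob_space (gegenbauer_distr \<kappa>)" if "\<kappa> > - 1/2" for \<kappa>
    using prob_space.prob_space_distr[OF M[OF that] rv[OF that]] distr[OF that] by simp
  have expect: "(\<integral>\<omega>. h (Z \<kappa> \<omega>) \<partial>M \<kappa>) = (\<integral>x. h x \<partial>gegenbauer_distr \<kappa>)"
    if "\<kappa> > - 1/2" "smooth h" for \<kappa> h
    using integral_distr[OF rv[OF that(1)] smooth_borel[OF that(2)]] distr[OF that(1)] by simp
  have unique: "is_gegenbauer_biased l m (gegenbauer_distr l) \<nu> \<longleftrightarrow> \<nu> = gegenbauer_distr (l + real m)" for \<nu>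
    by (rule is_gegenbauer_biased_iff[OF l prob[OF l] prob[OF lm]])
  have "(\<integral>\<omega>. poly (gegenbauer_poly l m) (Z l \<omega>) * F (Z l \<omega>) \<partial>M l) =
      gegenbauer_alpha l m * (\<integral>\<omega>. (deriv ^^ m) F (Z (l + real m) \<omega>) \<partial>M (l + real m))"
    if "F \<in> Cc_infty" for F
  proof -
    have F: "smooth F" using that by (simp add: Cc_infty_iff)
    have meas: "(\<lambda>x. poly (gegenbauer_poly l m) x * F x) \<in> borel_measurable borel"
      by (intro borel_measurable_times smooth_borel smooth_poly F)
    show ?thesis
      using gegenbauer_integral_identity[OF l prob[OF l] F, of m]
        integral_distr[OF rv[OF l] meas] expect[OF lm smooth_funpow_deriv[OF F]] distr[OF l]
      by simp
  qed
  then show ?thesis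
    by (simp add: distr[OF l] distr[OF lm] unique gegenbauer_biased_def)
qed

end
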